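(* Let $b=2$ and $x\in[0,1)$. If $0<x<1$ set $a_1=-\lfloor\log_2(x)\rfloor$, $t_1=2^{-a_1}$, $t_2=2^{-2a_1}$; if $x=0$ set $a_1=0$, $t_1=0$, $t_2=0$. Then $$\omega_2(x)=s_1(x)+\tilde s_2(x),\qquad \omega_3(x)=s_1(x)+s_2(x)+\tilde s_3(x),$$ where $$s_1(x)=1-2x,\qquad s_2(x)=\tfrac13-2(1-x)x,$$ $$\tilde s_2(x)=\frac{1-5t_1}{2}+(2-a_1)x,\qquad \tilde s_3(x)=\frac{1-43t_2}{18}+(5t_1-1)x-(2-a_1)x^2.$$
   Context: Base $b=2$. For $k\in\mathbb N$ write $k=\sum_{i=0}^a\kappa_i2^i$ with binary digits $\kappa_i\in\{0,1\}$; let $\#k$ be the number of non-zero digits, and write $k=\sum_{i=1}^{\#k}2^{c_i}$ with $c_1>\cdots>c_{\#k}\ge0$. For an integer $\alpha\ge2$ set $r_\alpha(k)=2^{-\sum_{i=1}^{\min(\#k,\alpha)}(c_i+1)}$. For $x=\sum_{i\ge1}\xi_i2^{-i}\in[0,1)$ with $\xi_i\in\{0,1\}$ not eventually all $1$, the $k$th Walsh function is $\mathrm{wal}_k(x)=\exp(2\pi\mathrm i(\xi_1\kappa_0+\cdots+\xi_{a+1}\kappa_a)/2)=(-1)^{\xi_1\kappa_0+\cdots+\xi_{a+1}\kappa_a}$. The function $\omega_\alpha$ is $\omega_\alpha(x)=\sum_{k=1}^\infty r_\alpha(k)\,\mathrm{wal}_k(x)$ (absolutely convergent for $\alpha\ge2$).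 *)

theory Defs
  imports "HOL-Analysis.Analysis" "HOL-Library.Log_Nat"
begin

definition nat_digit :: "nat \<Rightarrow> nat \<Rightarrow> nat" where
  "nat_digit k i = k div 2 ^ i mod 2"

text \<open>
  The number of binary digits of \<open>k > 0\<close> is \<open>floorlog 2 k\<close>, so its top digit has
  position \<open>floorlog 2 k - 1\<close>.
\<close>

lemma nat_digit_expansion: "k = (\<Sum>i<floorlog 2 k. nat_digit k i * 2 ^ i)"
proof -
  have "(\<Sum>i<n. nat_digit k i * 2 ^ i) = k mod 2 ^ n" for n
  proof (induction n)
    case (Suc n)
    then show ?case
      using mod_mult2_eq[of k "2 ^ n" 2] by (simp add: nat_digit_def mult.commute)
  qed simp
  moreover have "k < 2 ^ floorlog 2 k"
    using floorlog_bounds[of k 2] by (cases "k = 0") (auto simp: floorlog_def)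
  ultimately show ?thesis by simp
qed

text \<open>
  The list of positions of the nonzero digits of \<open>k\<close>, in decreasing order; \<open>c\<^sub>1\<close> is at list index 0.
\<close>

definition one_positions :: "nat \<Rightarrow> nat list" where
  "one_positions k = rev (filter (\<lambda>i. nat_digit k i \<noteq> 0) [0..<floorlog 2 k])"

definition r :: "nat \<Rightarrow> nat \<Rightarrow> real" where
  "r \<alpha> k = 1 / 2 ^ (\<Sum>i<min (length (one_positions k)) \<alpha>. one_positions k ! i + 1)"

text \<open>
  For \<open>x\<close> in \<open>[0,1)\<close> and \<open>i \<ge> 1\<close> this is the \<open>i\<close>th digit of the binary expansion of \<open>x\<close> that is
  not eventually 1; see the lemmas below.
\<close>

definition frac_digit :: "real \<Rightarrow> nat \<Rightarrow> nat" where
  "frac_digit x i = nat (\<lfloor>2 ^ i * x\<rfloor> mod 2)"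

lemma frac_digit_cases: "frac_digit x i \<in> {0, 1}"
  unfolding frac_digit_def by auto

lemma frac_digit_partial_sum:
  assumes "0 \<le> x" "x < 1"
  shows "(\<Sum>i<n. real (frac_digit x (Suc i)) / 2 ^ Suc i) = of_int \<lfloor>2 ^ n * x\<rfloor> / 2 ^ n"
proof (induction n)
  case 0
  have "\<lfloor>x\<rfloor> = 0" using assms by (simp add: floor_eq_iff)
  then show ?case by simp
next
  case (Suc n)
  have div2: "\<lfloor>2 ^ n * x\<rfloor> = \<lfloor>2 ^ Suc n * x\<rfloor> div 2"
    using floor_divide_real_eq_div[of 2 "2 ^ Suc n * x"] by simp
  have "\<lfloor>2 ^ Suc n * x\<rfloor> = 2 * \<lfloor>2 ^ n * x\<rfloor> + int (frac_digit x (Suc n))"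
    unfolding div2 frac_digit_def by simp
  then have "real_of_int \<lfloor>2 ^ Suc n * x\<rfloor> = 2 * \<lfloor>2 ^ n * x\<rfloor> + real (frac_digit x (Suc n))"
    by (metis of_int_add of_int_mult of_int_numeral of_int_of_nat_eq)
  with Suc show ?case by (simp add: field_simps)
qed

lemma frac_digit_sums:
  assumes "0 \<le> x" "x < 1"
  shows "(\<lambda>i. real (frac_digit x (Suc i)) / 2 ^ Suc i) sums x"
proof -
  have bound: "\<bar>of_int \<lfloor>2 ^ n * x\<rfloor> / 2 ^ n - x\<bar> \<le> (1/2) ^ n" for n :: nat
  proof -
    have "\<bar>of_int \<lfloor>2 ^ n * x\<rfloor> - 2 ^ n * x\<bar> \<le> 1" by linarith
    then have "\<bar>of_int \<lfloor>2 ^ n * x\<rfloor> - 2 ^ n * x\<bar> / 2 ^ n \<le> 1 / 2 ^ n"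
      by (simp add: divide_right_mono)
    also have "\<bar>of_int \<lfloor>2 ^ n * x\<rfloor> - 2 ^ n * x\<bar> / 2 ^ n
        = \<bar>(of_int \<lfloor>2 ^ n * x\<rfloor> - 2 ^ n * x) / 2 ^ n\<bar>" by simp
    also have "\<dots> = \<bar>of_int \<lfloor>2 ^ n * x\<rfloor> / 2 ^ n - x\<bar>" by (simp add: diff_divide_distrib)
    finally show ?thesis by (simp add: power_one_over)
  qed
  have "(\<lambda>n. of_int \<lfloor>2 ^ n * x\<rfloor> / 2 ^ n - x) \<longlonglongrightarrow> 0"
    by (rule Lim_null_comparison[where g = "\<lambda>n. (1/2) ^ n"])
      (use bound in \<open>auto intro!: LIMSEQ_power_zero\<close>)
  then show ?thesis
    unfolding sums_def frac_digit_partial_sum[OF assms] by (simp add: LIM_zero_iff)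
qed

lemma frac_digit_not_eventually_1:
  assumes "0 \<le> x" "x < 1"
  shows "\<not> (\<forall>\<^sub>F i in sequentially. frac_digit x i = 1)"
proof
  assume "\<forall>\<^sub>F i in sequentially. frac_digit x i = 1"
  then obtain N where N: "\<And>i. i \<ge> N \<Longrightarrow> frac_digit x i = 1"
    by (auto simp: eventually_sequentially)
  let ?f = "\<lambda>i. real (frac_digit x (Suc i)) / 2 ^ Suc i"
  have "(\<lambda>i. ?f (i + N)) sums (x - of_int \<lfloor>2 ^ N * x\<rfloor> / 2 ^ N)"
    using sums_split_initial_segment[OF frac_digit_sums[OF assms], of N]
    unfolding frac_digit_partial_sum[OF assms] .
  moreover have "(\<lambda>i. ?f (i + N)) = (\<lambda>i. (1/2) ^ Suc i * (1 / 2 ^ N))"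
    using N by (auto simp: power_add power_one_over field_simps)
  moreover have "(\<lambda>i. (1/2) ^ Suc i * (1 / 2 ^ N)) sums (1 * (1 / 2 ^ N) :: real)"
    by (intro sums_mult2 power_half_series)
  ultimately have "x - of_int \<lfloor>2 ^ N * x\<rfloor> / 2 ^ N = 1 / 2 ^ N"
    using sums_unique2 by fastforce
  then have "2 ^ N * x = of_int \<lfloor>2 ^ N * x\<rfloor> + 1" by (simp add: field_simps)
  then show False by linarith
qed

definition wal :: "nat \<Rightarrow> real \<Rightarrow> complex" where
  "wal k x = exp (2 * of_real pi * \<i> *
     of_nat (\<Sum>i<floorlog 2 k. frac_digit x (i + 1) * nat_digit k i) / 2)"

definition \<omega> :: "nat \<Rightarrow> real \<Rightarrow> complex" where
  "\<omega> \<alpha> x = (\<Sum>k. of_real (r \<alpha> (Suc k)) * wal (Suc k) x)"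

end

theory Submission
  imports Defs "HOL-Real_Asymp.Real_Asymp"
begin

text \<open>
  Splitting \<open>k < 2 ^ Suc n\<close> by its top digit gives, for the dyadic partial sums
  \<open>F\<^sub>\<alpha> n = (\<Sum>k<2 ^ n. r \<alpha> k * wal k x)\<close>, the recursion
  \<open>F\<^sub>\<alpha> (n + 1) = F\<^sub>\<alpha> n + \<sigma>\<^sub>n / 2 ^ (n + 1) * F\<^sub>\<alpha>\<^sub>-\<^sub>1 n\<close>, where \<open>\<sigma>\<^sub>n = \<plusminus>1\<close> is the sign of
  the digit \<open>n + 1\<close> of \<open>x\<close>. The sum \<open>F\<^sub>0\<close> is the Dirichlet kernel and vanishes as soon as a
  digit 1 has occurred, so \<open>F\<^sub>1\<close> is constant from there on, and \<open>F\<^sub>2\<close> and \<open>F\<^sub>3\<close> are a linear and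
  (up to a geometric term) a quadratic polynomial in \<open>\<Sum>i<n. \<sigma>\<^sub>i / 2 ^ (i + 1)\<close>, which tends
  to \<open>1 - 2 * x\<close>. Then \<open>\<omega> \<alpha> x\<close> is the limit of \<open>F\<^sub>\<alpha> n - 1\<close>; absolute convergence follows
  from the boundedness of \<open>F\<^sub>\<alpha>\<close> at \<open>x = 0\<close>.
\<close>

section \<open>Binary digits and splitting off the top digit\<close>

lemma nat_digit_eq_0: "k < 2 ^ i \<Longrightarrow> nat_digit k i = 0"
  by (simp add: nat_digit_def)

lemma less_two_power_floorlog: "k < 2 ^ floorlog 2 k"
  using floorlog_bounds[of k 2] by (cases "k = 0") (auto simp: floorlog_def)

lemma nat_digit_eq_0_floorlog: "floorlog 2 k \<le> i \<Longrightarrow> nat_digit k i = 0"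
  by (meson less_two_power_floorlog nat_digit_eq_0 one_le_numeral order_less_le_trans power_increasing)

lemma floorlog_le: "j < 2 ^ n \<Longrightarrow> floorlog 2 j \<le> n"
  by (simp add: floorlog_le_iff)

lemma floorlog_power_add: "j < 2 ^ n \<Longrightarrow> floorlog 2 (2 ^ n + j) = Suc n"
  by (intro antisym floorlog_leI floorlog_ge_SucI) auto

lemma nat_digit_power_add_less:
  assumes "i < n"
  shows "nat_digit (2 ^ n + j) i = nat_digit j i"
proof -
  obtain d where n: "n = Suc (i + d)"
    using assms less_iff_Suc_add by blast
  \<comment> \<open>Since \<open>i < n\<close>, the added power is an even multiple of
    \<open>2 ^ i\<close>, so the parity of the quotient does not change.\<close>
  have "(2::nat) ^ n = 2 * 2 ^ d * 2 ^ i"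
    by (simp add: n power_add)
  then have "(2 ^ n + j) div 2 ^ i = 2 * 2 ^ d + j div 2 ^ i"
    by (simp add: div_mult_self3)
  then show ?thesis
    by (simp add: nat_digit_def)
qed

lemma nat_digit_power_add_top: "j < 2 ^ n \<Longrightarrow> nat_digit (2 ^ n + j) n = 1"
  by (simp add: nat_digit_def div_add_self1)

text \<open>Digits beyond the top one vanish and are filtered out, so \<open>j\<close> and
  \<open>2 ^ n + j\<close> can be compared over a common index range.\<close>

lemma one_positions_upt:
  assumes "floorlog 2 k \<le> n"
  shows "one_positions k = rev (filter (\<lambda>i. nat_digit k i \<noteq> 0) [0..<n])"
proof -
  have "[0..<n] = [0..<floorlog 2 k] @ [floorlog 2 k..<n]"
    using assms upt_add_eq_append[of 0 "floorlog 2 k" "n - floorlog 2 k"] by simp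
  moreover have "filter (\<lambda>i. nat_digit k i \<noteq> 0) [floorlog 2 k..<n] = []"
    by (simp add: filter_empty_conv nat_digit_eq_0_floorlog)
  ultimately show ?thesis
    by (simp add: one_positions_def)
qed

lemma one_positions_power_add:
  assumes "j < 2 ^ n"
  shows "one_positions (2 ^ n + j) = n # one_positions j"
proof -
  have "filter (\<lambda>i. nat_digit (2 ^ n + j) i \<noteq> 0) [0..<n] = filter (\<lambda>i. nat_digit j i \<noteq> 0) [0..<n]"
    by (intro filter_cong) (auto simp: nat_digit_power_add_less)
  then show ?thesis
    using assms one_positions_upt[of "2 ^ n + j" "Suc n"] one_positions_upt[of j n]
    by (simp add: floorlog_le floorlog_power_add nat_digit_power_add_top)
qed

lemma r_0_left [simp]: "r 0 k = 1"
  by (simp add: r_def)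

lemma r_0_right [simp]: "r \<alpha> 0 = 1"
  by (simp add: r_def one_positions_def floorlog_def)

lemma r_nonneg [simp]: "r \<alpha> k \<ge> 0"
  by (simp add: r_def)

text \<open>The top position \<open>n\<close> comes first in the list: it uses up one of the
  \<open>Suc \<alpha>\<close> counted positions and contributes the exponent
  \<open>n + 1\<close>.\<close>

lemma r_power_add:
  assumes "j < 2 ^ n"
  shows "r (Suc \<alpha>) (2 ^ n + j) = r \<alpha> j / 2 ^ Suc n"
  using assms
  by (simp add: r_def one_positions_power_add sum.lessThan_Suc_shift power_add del: sum.lessThan_Suc)

section \<open>Walsh functions as real signs\<close>

definition digit_sign :: "real \<Rightarrow> nat \<Rightarrow> real" where
  "digit_sign x i = (- 1) ^ frac_digit x (Suc i)"

lemma digit_sign_eq: "digit_sign x i = 1 - 2 * real (frac_digit x (Suc i))"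
  using frac_digit_cases[of x "Suc i"] by (auto simp: digit_sign_def)

lemma digit_sign_0 [simp]: "digit_sign 0 i = 1"
  by (simp add: digit_sign_def frac_digit_def)

lemma digit_sign_sq [simp]: "digit_sign x i * digit_sign x i = 1"
  using frac_digit_cases[of x "Suc i"] by (auto simp: digit_sign_def)

definition walsh :: "nat \<Rightarrow> real \<Rightarrow> real" where
  "walsh k x = (- 1) ^ (\<Sum>i<floorlog 2 k. frac_digit x (i + 1) * nat_digit k i)"

lemma wal_eq_walsh: "wal k x = of_real (walsh k x)"
proof -
  define m where "m = (\<Sum>i<floorlog 2 k. frac_digit x (i + 1) * nat_digit k i)"
  have "wal k x = exp (of_nat m * (of_real pi * \<i>))"
    unfolding wal_def m_def[symmetric] by (simp add: algebra_simps)
  also have "\<dots> = (- 1) ^ m"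
    unfolding exp_of_nat_mult by simp
  finally show ?thesis
    by (simp add: walsh_def m_def)
qed

lemma walsh_0_left [simp]: "walsh 0 x = 1"
  by (simp add: walsh_def floorlog_def)

lemma walsh_0_right [simp]: "walsh k 0 = 1"
  by (simp add: walsh_def frac_digit_def)

lemma abs_walsh [simp]: "\<bar>walsh k x\<bar> = 1"
  by (simp add: walsh_def power_abs)

lemma walsh_upt:
  assumes "floorlog 2 k \<le> n"
  shows "walsh k x = (- 1) ^ (\<Sum>i<n. frac_digit x (i + 1) * nat_digit k i)"
proof -
  have "(\<Sum>i<n. frac_digit x (i + 1) * nat_digit k i)
      = (\<Sum>i<floorlog 2 k. frac_digit x (i + 1) * nat_digit k i)"
    using assms by (intro sum.mono_neutral_right) (auto simp: nat_digit_eq_0_floorlog)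
  then show ?thesis
    by (simp add: walsh_def)
qed

text \<open>Digit \<open>n\<close> of the index pairs with digit \<open>n + 1\<close> of
  \<open>x\<close>, so the new top digit adds just \<open>frac_digit x (Suc n)\<close> to the
  exponent.\<close>

lemma walsh_power_add:
  assumes "j < 2 ^ n"
  shows "walsh (2 ^ n + j) x = digit_sign x n * walsh j x"
  using assms walsh_upt[of "2 ^ n + j" "Suc n" x] walsh_upt[of j n x]
  by (simp add: floorlog_le floorlog_power_add nat_digit_power_add_top nat_digit_power_add_less power_add digit_sign_def)

section \<open>Dyadic partial sums and their recursion\<close>

definition dyadic_sum :: "nat \<Rightarrow> real \<Rightarrow> nat \<Rightarrow> real" where
  "dyadic_sum \<alpha> x n = (\<Sum>k<2 ^ n. r \<alpha> k * walsh k x)"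

lemma sum_lessThan_two_power_Suc:
  fixes f :: "nat \<Rightarrow> 'a::comm_monoid_add"
  shows "(\<Sum>k<2 ^ Suc n. f k) = (\<Sum>k<2 ^ n. f k) + (\<Sum>k<2 ^ n. f (2 ^ n + k))"
  using sum.shift_bounds_nat_ivl[of f 0 "2 ^ n" "2 ^ n"]
    sum.atLeastLessThan_concat[of 0 "2 ^ n" "2 ^ n + 2 ^ n" f]
  by (simp add: mult_2 add.commute flip: atLeast0LessThan)

lemma dyadic_sum_0 [simp]: "dyadic_sum \<alpha> x 0 = 1"
  by (simp add: dyadic_sum_def)

text \<open>The factor is 2 for a digit 0 of \<open>x\<close> and 0 for a digit 1.\<close>

lemma dyadic_sum_0_Suc:
  "dyadic_sum 0 x (Suc n) = (1 + digit_sign x n) * dyadic_sum 0 x n"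
proof -
  have "(\<Sum>k<2 ^ n. walsh (2 ^ n + k) x) = (\<Sum>k<2 ^ n. digit_sign x n * walsh k x)"
    by (intro sum.cong) (auto simp: walsh_power_add)
  then show ?thesis
    unfolding dyadic_sum_def sum_lessThan_two_power_Suc
    by (simp add: distrib_right flip: sum_distrib_left)
qed

lemma dyadic_sum_Suc_Suc:
  "dyadic_sum (Suc \<alpha>) x (Suc n)
    = dyadic_sum (Suc \<alpha>) x n + digit_sign x n * (1 / 2) ^ Suc n * dyadic_sum \<alpha> x n"
proof -
  have "(\<Sum>k<2 ^ n. r (Suc \<alpha>) (2 ^ n + k) * walsh (2 ^ n + k) x)
      = (\<Sum>k<2 ^ n. digit_sign x n * (1 / 2) ^ Suc n * (r \<alpha> k * walsh k x))"
    by (intro sum.cong) (auto simp: walsh_power_add r_power_add power_one_over)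
  then show ?thesis
    unfolding dyadic_sum_def sum_lessThan_two_power_Suc by (simp add: sum_distrib_left)
qed

lemmas dyadic_sum_numeral_Suc =
  dyadic_sum_Suc_Suc[of 0, unfolded One_nat_def[symmetric]]
  dyadic_sum_Suc_Suc[of 1, unfolded Suc_1]
  dyadic_sum_Suc_Suc[of 2, unfolded Suc_numeral add_num_simps]

text \<open>At 0 every Walsh value is 1, so \<open>bounded\<close> controls the sums of the
  coefficients themselves. Once the series converges, its value can be read off the partial sums of
  length \<open>2 ^ n\<close>. The 1 added to \<open>L\<close> is the term \<open>k = 0\<close>,
  which \<omega> omits.\<close>

lemma omega_eqI:
  assumes bounded: "\<And>n. dyadic_sum \<alpha> 0 n \<le> B"
    and lim: "dyadic_sum \<alpha> x \<longlonglongrightarrow> L + 1"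
  shows "\<omega> \<alpha> x = of_real L"
proof -
  define f where "f k = r \<alpha> k * walsh k x" for k
  have "(\<Sum>k\<le>n. norm (r \<alpha> k)) \<le> B" for n
  proof -
    have "(\<Sum>k\<le>n. norm (r \<alpha> k)) = (\<Sum>k\<le>n. r \<alpha> k)"
      by simp
    also have "\<dots> \<le> (\<Sum>k<2 ^ Suc n. r \<alpha> k)"
    proof (intro sum_mono2)
      show "{..n} \<subseteq> {..<2 ^ Suc n}"
        using less_exp[of "Suc n"] by (auto simp only: atMost_iff lessThan_iff)
    qed auto
    also have "\<dots> = dyadic_sum \<alpha> 0 (Suc n)"
      by (simp add: dyadic_sum_def)
    finally show ?thesis
      using bounded[of "Suc n"] by linarith
  qed
  then have "summable (r \<alpha>)"
    by (intro bounded_imp_summable) auto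
  then have "summable f"
    by (rule summable_comparison_test'[where N = 0]) (simp add: f_def abs_mult)
  then have "(\<lambda>N. sum f {..<N}) \<longlonglongrightarrow> suminf f"
    by (simp add: summable_LIMSEQ)
  moreover have "strict_mono (\<lambda>n::nat. 2 ^ n :: nat)"
    by (simp add: strict_mono_def)
  ultimately have "(\<lambda>n. sum f {..<2 ^ n}) \<longlonglongrightarrow> suminf f"
    using LIMSEQ_subseq_LIMSEQ[of "\<lambda>N. sum f {..<N}"] by (simp add: o_def)
  then have "suminf f = L + 1"
    using lim LIMSEQ_unique unfolding dyadic_sum_def f_def by blast
  then have "(\<Sum>k. f (Suc k)) = L"
    using suminf_split_head[OF \<open>summable f\<close>] by (simp add: f_def)
  moreover have "summable (\<lambda>k. f (Suc k))"
    using \<open>summable f\<close> by (simp only: summable_Suc_iff)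
  then have "complex_of_real (\<Sum>k. f (Suc k)) = (\<Sum>k. of_real (f (Suc k)))"
    by (rule suminf_of_real)
  then have "\<omega> \<alpha> x = of_real (\<Sum>k. f (Suc k))"
    by (simp only: \<omega>_def wal_eq_walsh f_def of_real_mult)
  ultimately show ?thesis
    by simp
qed

section \<open>Closed forms before and after the first digit 1\<close>

lemma dyadic_sum_leading_zeros:
  assumes "\<forall>i<n. digit_sign x i = 1"
  shows "dyadic_sum 0 x n = 2 ^ n"
    and "dyadic_sum 1 x n = 1 + real n / 2"
    and "dyadic_sum 2 x n = 5 / 2 - (3 + real n) / 2 * (1 / 2) ^ n"
    and "dyadic_sum 3 x n = 43 / 18 - 5 / 2 * (1 / 2) ^ n + (10 / 9 + real n / 3) * ((1 / 2) ^ n)\<^sup>2"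
proof -
  \<comment> \<open>The orders are treated jointly because each recursion uses the order below. The
    constants 5/2 and 43/18 are the limits for orders 2 and 3 when all digits are 0.\<close>
  have "dyadic_sum 0 x n = 2 ^ n
    \<and> dyadic_sum 1 x n = 1 + real n / 2
    \<and> dyadic_sum 2 x n = 5 / 2 - (3 + real n) / 2 * (1 / 2) ^ n
    \<and> dyadic_sum 3 x n = 43 / 18 - 5 / 2 * (1 / 2) ^ n + (10 / 9 + real n / 3) * ((1 / 2) ^ n)\<^sup>2"
    using assms
  proof (induction n)
    case 0
    then show ?case by simp
  next
    case (Suc n)
    define u :: real where "u = (1 / 2) ^ n"
    have u: "2 ^ n * u = 1" "(1 / 2) ^ Suc n = u / 2"
      by (simp_all add: u_def flip: power_mult_distrib)
    have "digit_sign x n = 1"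
      using Suc.prems by simp
    moreover have "\<forall>i<n. digit_sign x i = 1"
      using Suc.prems by simp
    note IH = Suc.IH[OF this, folded u_def]
    ultimately show ?case
      \<comment> \<open>The growth \<open>2 ^ n\<close> of order 0 cancels the weight
        \<open>u / 2\<close> up to 1/2, which is the gain of order 1 in each step.\<close>
      using u(1)
      by (simp only: dyadic_sum_numeral_Suc dyadic_sum_0_Suc u(2) IH)
        (simp add: field_simps power2_eq_square)
  qed
  then show "dyadic_sum 0 x n = 2 ^ n"
    and "dyadic_sum 1 x n = 1 + real n / 2"
    and "dyadic_sum 2 x n = 5 / 2 - (3 + real n) / 2 * (1 / 2) ^ n"
    and "dyadic_sum 3 x n = 43 / 18 - 5 / 2 * (1 / 2) ^ n + (10 / 9 + real n / 3) * ((1 / 2) ^ n)\<^sup>2"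
    by blast+
qed

definition signed_sum :: "real \<Rightarrow> nat \<Rightarrow> real" where
  "signed_sum x n = (\<Sum>i<n. digit_sign x i * (1 / 2) ^ Suc i)"

lemma signed_sum_Suc: "signed_sum x (Suc n) = signed_sum x n + digit_sign x n * (1 / 2) ^ Suc n"
  by (simp add: signed_sum_def)

text \<open>Each sign is 1 minus twice a digit, so the series is a geometric series minus twice the
  binary expansion of \<open>x\<close>.\<close>

lemma signed_sum_tendsto:
  assumes "0 \<le> x" "x < 1"
  shows "signed_sum x \<longlonglongrightarrow> 1 - 2 * x"
proof -
  have "(\<lambda>i. (1 / 2) ^ Suc i - 2 * (real (frac_digit x (Suc i)) / 2 ^ Suc i)) sums (1 - 2 * x)"
    by (intro sums_diff sums_mult power_half_series frac_digit_sums assms)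
  moreover have "(1 / 2) ^ Suc i - 2 * (real (frac_digit x (Suc i)) / 2 ^ Suc i)
      = digit_sign x i * (1 / 2) ^ Suc i" for i
    by (simp add: digit_sign_eq power_one_over field_simps)
  ultimately show ?thesis
    unfolding signed_sum_def sums_def by (simp only:)
qed

lemma signed_sum_leading_zeros:
  assumes "\<forall>i<n. digit_sign x i = 1"
  shows "signed_sum x n = 1 - (1 / 2) ^ n"
  using assms by (induction n) (auto simp: signed_sum_Suc signed_sum_def)

text \<open>The first digit 1 of \<open>x\<close> is at position \<open>Suc m\<close>. From there on
  order 1 stays at \<open>a / 2\<close>, so order 2 is affine in \<open>signed_sum\<close>, with
  \<open>C\<close> fitted at \<open>n = Suc m\<close>. In order 3, summing \<open>signed_sum\<close>
  against its increments gives half its square, up to the squared increments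
  \<open>(1 / 4) ^ Suc n\<close>; the term \<open>1 / 3 * ((1 / 2) ^ n) ^ 2\<close> compensates
  these exactly. The constant part is again fitted at \<open>n = Suc m\<close>.\<close>

lemma dyadic_sum_after_first_one:
  fixes x :: real and m :: nat
  defines "a \<equiv> real (Suc m)" and "t \<equiv> (1 / 2) ^ Suc m"
  defines "C \<equiv> (5 - 5 * t - a) / 2"
  assumes zeros: "\<forall>i<m. digit_sign x i = 1" and one: "digit_sign x m = - 1"
    and "Suc m \<le> n"
  shows "dyadic_sum 2 x n = C + a / 2 * signed_sum x n"
    and "dyadic_sum 3 x n = 43 / 18 * (1 - t\<^sup>2) - C - a / 4 + C * signed_sum x n
      + a / 4 * ((signed_sum x n)\<^sup>2 + 1 / 3 * ((1 / 2) ^ n)\<^sup>2)"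
proof -
  have "dyadic_sum 0 x n = 0 \<and> dyadic_sum 1 x n = a / 2
    \<and> dyadic_sum 2 x n = C + a / 2 * signed_sum x n
    \<and> dyadic_sum 3 x n = 43 / 18 * (1 - t\<^sup>2) - C - a / 4 + C * signed_sum x n
      + a / 4 * ((signed_sum x n)\<^sup>2 + 1 / 3 * ((1 / 2) ^ n)\<^sup>2)"
    using \<open>Suc m \<le> n\<close>
  proof (induction n rule: dec_induct)
    \<comment> \<open>The sign -1 at index \<open>m\<close> makes the factor
      \<open>1 + digit_sign x m\<close> vanish, which annihilates order 0.\<close>
    case base
    define u :: real where "u = (1 / 2) ^ m"
    have u: "2 ^ m * u = 1" "(1 / 2) ^ Suc m = u / 2"
      by (simp_all add: u_def flip: power_mult_distrib)
    note start = dyadic_sum_leading_zeros[of m x, OF zeros, folded u_def]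
      signed_sum_leading_zeros[of m x, OF zeros, folded u_def]
    show ?case
      unfolding dyadic_sum_numeral_Suc dyadic_sum_0_Suc signed_sum_Suc start one a_def t_def C_def u(2)
      using u(1) by (simp add: field_simps power2_eq_square)
  next
    case (step n)
    define u y s where "u = (1 / 2 :: real) ^ n" and "y = signed_sum x n" and "s = digit_sign x n"
    have u: "(1 / 2) ^ Suc n = u / 2"
      by (simp add: u_def)
    \<comment> \<open>Hence the squared increment of \<open>y\<close> is \<open>(u / 2) ^ 2\<close>
      whatever the sign.\<close>
    have "s * (s * z) = z" for z
      by (simp add: s_def flip: mult.assoc)
    then show ?case
      unfolding dyadic_sum_numeral_Suc dyadic_sum_0_Suc signed_sum_Suc u
      by (simp only: step.IH flip: u_def y_def s_def)
        (simp add: field_simps power2_eq_square)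
  qed
  then show "dyadic_sum 2 x n = C + a / 2 * signed_sum x n"
    and "dyadic_sum 3 x n = 43 / 18 * (1 - t\<^sup>2) - C - a / 4 + C * signed_sum x n
      + a / 4 * ((signed_sum x n)\<^sup>2 + 1 / 3 * ((1 / 2) ^ n)\<^sup>2)"
    by blast+
qed

section \<open>Bounds at 0, for absolute convergence\<close>

lemma dyadic_sum_at_0:
  "dyadic_sum 2 0 n = 5 / 2 - (3 + real n) / 2 * (1 / 2) ^ n"
  "dyadic_sum 3 0 n = 43 / 18 - 5 / 2 * (1 / 2) ^ n + (10 / 9 + real n / 3) * ((1 / 2) ^ n)\<^sup>2"
  by (rule dyadic_sum_leading_zeros; simp)+

lemma dyadic_sum_2_bounded: "dyadic_sum 2 0 n \<le> 5 / 2"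
  by (simp add: dyadic_sum_at_0)

text \<open>The positive term of order \<open>n / 4 ^ n\<close> is absorbed by the subtracted
  \<open>5 / 2 * (1 / 2) ^ n\<close>, because \<open>n < 2 ^ n\<close>.\<close>

lemma dyadic_sum_3_bounded: "dyadic_sum 3 0 n \<le> 43 / 18"
proof -
  have "real n < 2 ^ n" "(1::real) \<le> 2 ^ n"
    by auto
  then have "10 / 9 + real n / 3 \<le> 5 / 2 * (2::real) ^ n"
    by linarith
  then have "(10 / 9 + real n / 3) * ((1 / 2) ^ n)\<^sup>2 \<le> 5 / 2 * 2 ^ n * ((1 / 2 :: real) ^ n)\<^sup>2"
    by (intro mult_right_mono) auto
  also have "\<dots> = 5 / 2 * (1 / 2) ^ n"
    by (simp add: power2_eq_square power_one_over)
  finally show ?thesis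
    unfolding dyadic_sum_at_0 by linarith
qed

section \<open>Locating the first digit 1 and passing to the limit\<close>

lemma digit_sign_leading:
  assumes "1 / 2 ^ Suc m \<le> x" "x < 1 / 2 ^ m"
  shows "\<forall>i<m. digit_sign x i = 1" and "digit_sign x m = - 1"
proof -
  have "0 < x"
    using assms(1) by (rule less_le_trans[rotated]) simp
  \<comment> \<open>Scaling by \<open>2 ^ Suc m\<close> moves \<open>x\<close> into [1, 2), while
    powers up to \<open>2 ^ m\<close> keep it below 1.\<close>
  have "\<lfloor>2 ^ Suc m * x\<rfloor> = 1"
    using assms by (intro floor_unique) (auto simp: field_simps)
  then show "digit_sign x m = - 1"
    by (simp add: digit_sign_def frac_digit_def)
  show "\<forall>i<m. digit_sign x i = 1"
  proof (intro allI impI)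
    fix i assume "i < m"
    then have "(2::real) ^ Suc i \<le> 2 ^ m"
      by (intro power_increasing) auto
    then have "2 ^ Suc i * x \<le> 2 ^ m * x"
      using \<open>0 < x\<close> by (intro mult_right_mono) auto
    also have "\<dots> < 1"
      using assms(2) by (simp add: field_simps)
    finally have "\<lfloor>2 ^ Suc i * x\<rfloor> = 0"
      using \<open>0 < x\<close> by (intro floor_unique) auto
    then show "digit_sign x i = 1"
      by (simp add: digit_sign_def frac_digit_def)
  qed
qed

theorem corollary1:
  fixes x t\<^sub>1 t\<^sub>2 s\<^sub>1 s\<^sub>2 s2_tilde s3_tilde :: real and a\<^sub>1 :: int
  assumes "0 \<le> x" and "x < 1"
    and "0 < x \<Longrightarrow> a\<^sub>1 = - \<lfloor>log 2 x\<rfloor> \<and> t\<^sub>1 = 2 powi (- a\<^sub>1) \<and> t\<^sub>2 = 2 powi (- 2 * a\<^sub>1)"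
    and "x = 0 \<Longrightarrow> a\<^sub>1 = 0 \<and> t\<^sub>1 = 0 \<and> t\<^sub>2 = 0"
    and "s\<^sub>1 = 1 - 2 * x"
    and "s\<^sub>2 = 1 / 3 - 2 * (1 - x) * x"
    and "s2_tilde = (1 - 5 * t\<^sub>1) / 2 + (2 - of_int a\<^sub>1) * x"
    and "s3_tilde = (1 - 43 * t\<^sub>2) / 18 + (5 * t\<^sub>1 - 1) * x - (2 - of_int a\<^sub>1) * x\<^sup>2"
  shows "\<omega> 2 x = of_real (s\<^sub>1 + s2_tilde) \<and> \<omega> 3 x = of_real (s\<^sub>1 + s\<^sub>2 + s3_tilde)"
proof (cases "x = 0")
  case True
  \<comment> \<open>No digit 1 ever occurs at 0, so the formulas for leading zeros hold for every
    \<open>n\<close>.\<close>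
  have "dyadic_sum 2 0 \<longlonglongrightarrow> 5 / 2"
    unfolding dyadic_sum_at_0[abs_def] by real_asymp
  then have "\<omega> 2 0 = of_real (3 / 2)"
    by (intro omega_eqI[OF dyadic_sum_2_bounded]) simp
  moreover have "dyadic_sum 3 0 \<longlonglongrightarrow> 43 / 18"
    unfolding dyadic_sum_at_0[abs_def] by real_asymp
  then have "\<omega> 3 0 = of_real (25 / 18)"
    by (intro omega_eqI[OF dyadic_sum_3_bounded]) simp
  moreover have "s\<^sub>1 + s2_tilde = 3 / 2" "s\<^sub>1 + s\<^sub>2 + s3_tilde = 25 / 18"
    using True assms by simp_all
  ultimately show ?thesis
    using True by metis
next
  case False
  then have "0 < x"
    using assms(1) by simp
  then have a1: "a\<^sub>1 = - \<lfloor>log 2 x\<rfloor>" and t1_powi: "t\<^sub>1 = 2 powi (- a\<^sub>1)"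
    and t2_powi: "t\<^sub>2 = 2 powi (- 2 * a\<^sub>1)"
    using assms(3) by blast+
  have "log 2 x < 0"
    using \<open>0 < x\<close> assms(2) by simp
  then have "0 < a\<^sub>1"
    using a1 by linarith
  \<comment> \<open>The number of zero digits before the first 1; thus the \<open>a\<close> and
    \<open>t\<close> of the closed forms are \<open>a\<^sub>1\<close> and
    \<open>t\<^sub>1\<close>.\<close>
  define m where "m = nat (a\<^sub>1 - 1)"
  have a1_eq: "a\<^sub>1 = int (Suc m)"
    using \<open>0 < a\<^sub>1\<close> by (simp add: m_def)
  have t1: "t\<^sub>1 = (1 / 2) ^ Suc m"
    unfolding t1_powi a1_eq by (simp only: power_int_minus power_int_of_nat power_one_over inverse_eq_divide)
  have "- 2 * a\<^sub>1 = - a\<^sub>1 + - a\<^sub>1"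
    by simp
  then have t2: "t\<^sub>2 = t\<^sub>1\<^sup>2"
    unfolding t2_powi t1_powi power2_eq_square by (metis power_int_add zero_neq_numeral)
  \<comment> \<open>The floor of the logarithm is \<open>- Suc m\<close>, which places
    \<open>x\<close> in the dyadic interval from \<open>2 ^ (- Suc m)\<close> up to but excluding
    \<open>2 ^ (- m)\<close>.\<close>
  have "- real (Suc m) \<le> log 2 x" "log 2 x < - real m"
    using floor_correct[of "log 2 x"] a1 a1_eq by linarith+
  then have "2 powr (- real (Suc m)) \<le> x" "x < 2 powr (- real m)"
    using \<open>0 < x\<close> by (simp_all only: le_log_iff log_less_iff one_less_numeral_iff semiring_norm)
  then have "1 / 2 ^ Suc m \<le> x" "x < 1 / 2 ^ m"
    by (simp_all only: powr_minus_divide powr_realpow zero_less_numeral)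
  note sums = dyadic_sum_after_first_one[OF digit_sign_leading[OF this], folded t1]
  note lim = signed_sum_tendsto[OF assms(1,2)]
  define a C where "a = real (Suc m)" and "C = (5 - 5 * t\<^sub>1 - a) / 2"
  have "(\<lambda>n. C + a / 2 * signed_sum x n) \<longlonglongrightarrow> C + a / 2 * (1 - 2 * x)"
    by (intro tendsto_intros lim)
  \<comment> \<open>The closed form is available only from \<open>n = Suc m\<close> on, which
    suffices for the limit.\<close>
  also have "?this \<longleftrightarrow> dyadic_sum 2 x \<longlonglongrightarrow> C + a / 2 * (1 - 2 * x)"
    using sums(1)
    by (intro filterlim_cong refl eventually_sequentiallyI[of "Suc m"]) (simp add: C_def a_def)
  also have "C + a / 2 * (1 - 2 * x) = s\<^sub>1 + s2_tilde + 1"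
    using assms(5,7) by (simp add: C_def a_def a1_eq field_simps)
  finally have "\<omega> 2 x = of_real (s\<^sub>1 + s2_tilde)"
    by (rule omega_eqI[OF dyadic_sum_2_bounded])
  let ?K = "43 / 18 * (1 - t\<^sub>1\<^sup>2) - C - a / 4"
  \<comment> \<open>The geometric correction tends to 0, leaving a quadratic polynomial in
    \<open>1 - 2 * x\<close>.\<close>
  have "(\<lambda>n. ?K + C * signed_sum x n + a / 4 * ((signed_sum x n)\<^sup>2 + 1 / 3 * ((1 / 2) ^ n)\<^sup>2))
      \<longlonglongrightarrow> ?K + C * (1 - 2 * x) + a / 4 * ((1 - 2 * x)\<^sup>2 + 0)"
    by (intro tendsto_intros lim) real_asymp
  also have "?this \<longleftrightarrow> dyadic_sum 3 x
      \<longlonglongrightarrow> ?K + C * (1 - 2 * x) + a / 4 * ((1 - 2 * x)\<^sup>2 + 0)"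
    using sums(2)
    by (intro filterlim_cong refl eventually_sequentiallyI[of "Suc m"]) (simp add: C_def a_def)
  also have "?K + C * (1 - 2 * x) + a / 4 * ((1 - 2 * x)\<^sup>2 + 0) = s\<^sub>1 + s\<^sub>2 + s3_tilde + 1"
    unfolding assms(5,6,8) t2 C_def a_def a1_eq by (simp add: field_simps power2_eq_square)
  finally have "\<omega> 3 x = of_real (s\<^sub>1 + s\<^sub>2 + s3_tilde)"
    by (rule omega_eqI[OF dyadic_sum_3_bounded])
  with \<open>\<omega> 2 x = _\<close> show ?thesis
    by blast
qed

end
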